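(* Let $S_8=(s_0,s_1,\dots,s_{23})$ be the sequence $$(8,7,6,5,4,3,\ 8,7,6,5,4,3,\ 4,3,2,1,0,-1,\ 4,3,2,1,0,-1).$$ Let $\varphi_8:\mathbb{N}\to\mathbb{N}$ be the function defined as follows. The values $\varphi_8(0),\varphi_8(1),\dots,\varphi_8(63)$ are, in order (ten per row), $$\begin{array}{l}6,7,8,9,10,11,0,1,2,3,\\ 4,5,16,17,22,23,12,13,20,21,\\ 18,19,14,15,30,31,32,33,34,35,\\ 24,25,26,27,28,29,40,41,44,45,\\ 36,37,48,49,38,39,52,53,42,43,\\ 56,57,46,47,60,61,50,51,62,63,\\ 54,55,58,59,\end{array}$$ and for $x\ge 64$, $$\varphi_8(x)=x\oplus_{s_{x-64}}6=\bigl((x+s_{x-64})\oplus 6\bigr)-s_{x-64},$$ where the index $x-64$ is taken modulo $24$. Then, for all nonnegative integers $a,b$, the Halve Nim position $a^1b^18^1$ is a $\mathcal{P}$-position if and only if $b=\varphi_8(a)$.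
   Context: $\mathbb{N}$ is the set of nonnegative integers and $\oplus$ denotes bitwise XOR. The $n$-shifted bitwise sum, for an integer $n$, is $x\oplus_n y=\bigl((x+n)\oplus y\bigr)-n$. Halve Nim is a two-player game played on finitely many piles of coins; players alternate moves and a player who cannot move loses. A move is one of: (i) choose one pile and remove at least one coin from it; (ii) halve the game: simultaneously replace every pile of $m$ coins by a pile of $\lfloor m/2\rfloor$ coins. When there are no coins left, no move is available (halving requires at least one coin to be present). A position is a $\mathcal{P}$-position if the player who is not about to move has a winning strategy (equivalently, every move from it leads to an $\mathcal{N}$-position), and an $\mathcal{N}$-position if the player about to move has a winning strategy. $a^1b^1c^1$ denotes the position with three piles of sizes $a$, $b$, $c$ (a pile of size $0$ is an empty pile); in particular $a^1b^18^1$ has piles of sizes $a$, $b$, $8$. *)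

theory Defs
  imports Complex_Main "HOL-Library.Multiset"
begin

text \<open>
  A position is the multiset of its pile sizes; piles of size 0 are allowed.
\<close>

inductive halve_nim_move :: "nat multiset \<Rightarrow> nat multiset \<Rightarrow> bool" where
  remove: "m \<in># p \<Longrightarrow> k < m \<Longrightarrow> halve_nim_move p (add_mset k (p - {#m#}))"
| halve: "\<exists>m \<in># p. 0 < m \<Longrightarrow> halve_nim_move p (image_mset (\<lambda>m. m div 2) p)"

text \<open>
  Normal play: a position without moves is a P-position, by the vacuous case of the
  first rule. As every move decreases the total number of coins, the least fixed point
  classifies every position exactly once (\<open>N_position_iff_not_P_position\<close>).
\<close>

inductive P_position :: "nat multiset \<Rightarrow> bool"
  and N_position :: "nat multiset \<Rightarrow> bool" where
  P_positionI: "(\<And>q. halve_nim_move p q \<Longrightarrow> N_position q) \<Longrightarrow> P_position p"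
| N_positionI: "halve_nim_move p q \<Longrightarrow> P_position q \<Longrightarrow> N_position p"

lemma halve_nim_move_sum_mset_less:
  assumes "halve_nim_move p q"
  shows "\<Sum>\<^sub># q < \<Sum>\<^sub># p"
  using assms
proof cases
  case (remove m k)
  then obtain r where "p = add_mset m r"
    by (meson multi_member_split)
  with remove show ?thesis by simp
next
  case halve
  then obtain m r where p: "p = add_mset m r" and m: "0 < m"
    by (meson multi_member_split)
  have "\<Sum>\<^sub># (image_mset (\<lambda>m. m div 2) r) \<le> \<Sum>\<^sub># r"
    by (induction r) auto
  moreover have "m div 2 < m"
    using m by simp
  ultimately show ?thesis
    using halve p by simp
qed

lemma N_position_iff_not_P_position: "N_position p \<longleftrightarrow> \<not> P_position p"
proof (induction "\<Sum>\<^sub># p" arbitrary: p rule: less_induct)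
  case less
  have IH: "N_position q \<longleftrightarrow> \<not> P_position q" if "halve_nim_move p q" for q
    using less halve_nim_move_sum_mset_less[OF that] by blast
  show ?case
    by (subst N_position.simps, subst P_position.simps) (use IH in blast)
qed

definition shifted_xor :: "int \<Rightarrow> int \<Rightarrow> int \<Rightarrow> int" where
  "shifted_xor n x y = Bit_Operations.xor (x + n) y - n"

definition S8 :: "int list" where
  "S8 = [8, 7, 6, 5, 4, 3, 8, 7, 6, 5, 4, 3, 4, 3, 2, 1, 0, -1, 4, 3, 2, 1, 0, -1]"

definition phi8_initial :: "nat list" where
  "phi8_initial =
    [ 6,  7,  8,  9, 10, 11,  0,  1,  2,  3,
      4,  5, 16, 17, 22, 23, 12, 13, 20, 21,
     18, 19, 14, 15, 30, 31, 32, 33, 34, 35,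
     24, 25, 26, 27, 28, 29, 40, 41, 44, 45,
     36, 37, 48, 49, 38, 39, 52, 53, 42, 43,
     56, 57, 46, 47, 60, 61, 50, 51, 62, 63,
     54, 55, 58, 59]"

text \<open>
  The conversion \<open>nat\<close> never truncates here: see \<open>int_phi8\<close>.
\<close>

definition phi8 :: "nat \<Rightarrow> nat" where
  "phi8 x = (if x < 64 then phi8_initial ! x
             else nat (shifted_xor (S8 ! ((x - 64) mod 24)) (int x) 6))"

lemma length_S8: "length S8 = 24"
  by (simp add: S8_def)

lemma length_phi8_initial: "length phi8_initial = 64"
  by (simp add: phi8_initial_def)

lemma xor_6_ge:
  fixes z :: int
  shows "z - 6 \<le> Bit_Operations.xor z 6"
proof -
  have "Bit_Operations.xor z 6 = of_bool (odd z) + 2 * Bit_Operations.xor (z div 2) 3"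
    by (subst xor_int_rec) simp
  moreover have "Bit_Operations.xor (z div 2) 3 =
      of_bool (even (z div 2)) + 2 * Bit_Operations.xor (z div 2 div 2) 1"
    by (subst xor_int_rec) simp
  moreover have "z div 2 div 2 - 1 \<le> Bit_Operations.xor (z div 2 div 2) 1"
    by (simp add: xor_one_eq)
  moreover have "z = 2 * (z div 2) + of_bool (odd z)"
    by (simp add: odd_two_times_div_two_succ)
  moreover have "z div 2 \<le> 2 * (z div 2 div 2) + 1"
    by linarith
  moreover have "0 \<le> (of_bool (even (z div 2)) :: int)"
    by simp
  ultimately show ?thesis
    by linarith
qed

lemma int_phi8:
  assumes "64 \<le> x"
  shows "int (phi8 x) = shifted_xor (S8 ! ((x - 64) mod 24)) (int x) 6"
proof -
  have "0 \<le> shifted_xor s (int x) 6" for s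
    using xor_6_ge[of "int x + s"] assms by (simp add: shifted_xor_def)
  then show ?thesis
    using assms by (simp add: phi8_def)
qed

end

theory Submission
  imports Defs
begin

text \<open>
  For every third pile \<open>c \<le> 8\<close> the P-positions \<open>(a, b, c)\<close> are the graph of an involution
  \<open>partner c\<close>; all nine are needed simultaneously, since moves lead from \<open>c\<close> to every smaller
  pile and to \<open>c div 2\<close>. For large \<open>x\<close> the offset \<open>partner c x - x\<close> is periodic if \<open>c \<ge> 4\<close>, and
  for \<open>c < 4\<close> it alternates between two periodic patterns on the intervals from \<open>28 * 2 ^ k\<close> to
  \<open>28 * 2 ^ (k + 1)\<close>, as halving maps each interval onto the preceding one. The offsets are at most
  9, so the conditions that make these graphs the P-positions are local: they follow from a
  computation for small \<open>x\<close> and one over the residues of \<open>x\<close> for each of the two patterns.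
\<close>

section \<open>The candidate involutions\<close>

definition initial_row :: "nat \<Rightarrow> int list" where
  "initial_row c =
    (if c = 0 then
       [0, 2, 1, 3, 4, 5, 8, 9, 6, 7, 12, 13, 10, 11, 14,
        15, 16, 17, 18, 19, 20, 21, 22, 23, 24, 25, 26, 27, 30, 31]
     else if c = 1 then
       [2, 3, 0, 1, 5, 4, 9, 8, 7, 6, 13, 12, 11, 10, 15,
        14, 17, 16, 19, 18, 21, 20, 23, 22, 25, 24, 27, 26, 31, 30]
     else if c = 2 then
       [1, 0, 2, 4, 3, 6, 5, 7, 8, 9, 10, 11, 12, 13, 18,
        19, 20, 21, 14, 15, 16, 17, 26, 27, 28, 29, 22, 23, 24, 25]
     else if c = 3 then
       [3, 1, 4, 0, 2, 7, 6, 5, 9, 8, 11, 10, 13, 12, 19,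
        18, 21, 20, 15, 14, 17, 16, 27, 26, 29, 28, 23, 22, 25, 24]
     else if c = 4 then
       [4, 5, 3, 2, 0, 1, 7, 6, 10, 11, 8, 9, 14, 15, 12,
        13, 18, 19, 16, 17, 22, 23, 20, 21, 26, 27, 24, 25, 28, 29]
     else if c = 5 then
       [5, 4, 6, 7, 1, 0, 2, 3, 11, 10, 9, 8, 15, 14, 13,
        12, 19, 18, 17, 16, 23, 22, 21, 20, 27, 26, 25, 24, 29, 28]
     else if c = 6 then
       [8, 9, 5, 6, 7, 2, 3, 4, 0, 1, 16, 17, 18, 19, 20,
        21, 10, 11, 12, 13, 14, 15, 24, 25, 22, 23, 28, 29, 26, 27]
     else if c = 7 then
       [9, 8, 7, 5, 6, 3, 4, 2, 1, 0, 17, 16, 19, 18, 21,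
        20, 11, 10, 13, 12, 15, 14, 25, 24, 23, 22, 29, 28, 27, 26]
     else
       [6, 7, 8, 9, 10, 11, 0, 1, 2, 3, 4, 5, 16, 17, 22,
        23, 12, 13, 20, 21, 18, 19, 14, 15, 30, 31, 32, 33, 34, 35,
        24, 25, 26, 27, 28, 29, 40, 41, 44, 45, 36, 37, 48, 49, 38,
        39, 52, 53, 42, 43, 56, 57, 46, 47, 60, 61, 50, 51, 62, 63,
        54, 55, 58, 59])"

text \<open>
  Offsets \<open>partner c x - x\<close> beyond the initial segment, indexed by \<open>x\<close> modulo the length of the row.
\<close>

definition offsets :: "nat \<Rightarrow> int list" where
  "offsets c =
    (if c = 0 then [0]
     else if c = 1 then [1, -1]
     else if c = 2 then [2, 2, -2, -2]
     else if c = 3 then [3, 1, -1, -3]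
     else if c = 4 then [-2, -2, 2, 2]
     else if c = 5 then [-1, -3, 3, 1]
     else if c = 6 then [4, 4, -4, -4, -4, -4, 4, 4]
     else if c = 7 then [5, 3, -3, -5, -3, -5, 5, 3]
     else [-6, -6, -6, -6, 6, 6, 6, 6, 6, 6, -6, -6])"

text \<open>The flag \<open>t\<close> exchanges the patterns of 0 and 2 and those of 1 and 3. For
  \<open>c = 0\<close> the identity cannot serve at both \<open>x div 2\<close> and
  \<open>x > 0\<close>, since (x, x, 0) would then halve to a P-position.\<close>

definition tail :: "bool \<Rightarrow> nat \<Rightarrow> int \<Rightarrow> int" where
  "tail t c x = (let row = offsets (if t then if c < 2 then c + 2 else if c < 4 then c - 2 else c else c)
    in x + row ! nat (x mod int (length row)))"

text \<open>
  Which of the two patterns is in force at \<open>x\<close> (the argument \<open>t\<close> of \<open>tail\<close>).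
\<close>

function swapped :: "int \<Rightarrow> bool" where
  "swapped x = (if x < 28 then False else \<not> swapped (x div 2))"
  by auto
termination by (relation "measure nat") auto
declare swapped.simps [simp del]

text \<open>Being the identity on negatives makes the range \<open>x - 9 \<le> y\<close> harmless
  near 0 and lets involutivity force nonnegative values.\<close>

definition partner :: "nat \<Rightarrow> int \<Rightarrow> int" where
  "partner c x = (if x < 0 then x
    else if x < (if c = 8 then 64 else 30) then initial_row c ! nat x
    else tail (swapped x) c x)"

section \<open>Local conditions and their finite checks\<close>

text \<open>
  \<open>F\<close> stands for the involutions near \<open>x\<close> and \<open>H\<close> for those near \<open>x div 2\<close>. The fourth and fifth
  conditions say that no move joins two positions of the graphs. The last one concerns the
  positions \<open>(x, y, c)\<close> from which reducing \<open>x\<close> or \<open>y\<close> does not reach the graph of \<open>F c\<close>.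
\<close>

definition locally_valid :: "(nat \<Rightarrow> int \<Rightarrow> int) \<Rightarrow> (nat \<Rightarrow> int \<Rightarrow> int) \<Rightarrow> nat \<Rightarrow> int \<Rightarrow> bool" where
  "locally_valid F H c x \<longleftrightarrow>
    x - 9 \<le> F c x \<and> F c x \<le> x + 9 \<and> F c (F c x) = x \<and> (\<forall>c'<c. F c' x \<noteq> F c x) \<and>
    (H (c div 2) (x div 2) = F c x div 2 \<longrightarrow> x = 0 \<and> c = 0) \<and>
    (\<forall>y. x - 9 \<le> y \<longrightarrow> y < F c x \<longrightarrow> x < F c y \<longrightarrow>
      H (c div 2) (x div 2) = y div 2 \<or> (\<exists>c'<c. F c' x = y))"

text \<open>
  Conditionals replace connectives because \<open>code_simp\<close> evaluates both sides of a connective but only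
  the chosen branch of a conditional.
\<close>

definition locally_valid_at :: "(nat \<Rightarrow> int \<Rightarrow> int) \<Rightarrow> (nat \<Rightarrow> int \<Rightarrow> int) \<Rightarrow> nat \<Rightarrow> int \<Rightarrow> int \<Rightarrow> bool" where
  "locally_valid_at F H c x z \<longleftrightarrow>
    x - 9 \<le> z \<and> z \<le> x + 9 \<and> F c z = x \<and> (\<forall>c'\<in>set [0..<c]. F c' x \<noteq> z) \<and>
    (if H (c div 2) (x div 2) = z div 2 then x = 0 \<and> c = 0 else True) \<and>
    (\<forall>y\<in>set [x-9..z-1]. if x < F c y
       then if H (c div 2) (x div 2) = y div 2 then True else (\<exists>c'\<in>set [0..<c]. F c' x = y) else True)"

text \<open>Passing \<open>F c x\<close> as an argument lets it be evaluated once and bounds the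
  range of \<open>y\<close>.\<close>

lemma locally_valid_code [code]: "locally_valid F H c x \<longleftrightarrow> locally_valid_at F H c x (F c x)"
proof -
  have "y \<in> set [x-9..F c x - 1] \<longleftrightarrow> x - 9 \<le> y \<and> y < F c x" for y
    by auto
  then show ?thesis
    unfolding locally_valid_def locally_valid_at_def Ball_def Bex_def by auto
qed

text \<open>A period for both values of \<open>t\<close>: the exchange gives \<open>c = 0\<close>
  and \<open>c = 1\<close> rows of length 4.\<close>

definition period :: "nat \<Rightarrow> int" where
  "period c = (if c < 6 then 4 else if c < 8 then 8 else 12)"

text \<open>
  Where the finite check stops: beyond it, all values involved in the conditions at \<open>x\<close> are
  given by \<open>tail\<close>.
\<close>

definition tail_start :: "nat \<Rightarrow> int" where
  "tail_start c = (if c = 8 then 73 else 60)"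

lemma locally_valid_small:
  "\<forall>c\<in>set [0..<9]. \<forall>x\<in>set [0..tail_start c - 1]. locally_valid partner partner c x"
  by code_simp

text \<open>Twice the period, because \<open>x div 2\<close> shifts by half as much as
  \<open>x\<close>. The flags are opposite, because halving changes the pattern.\<close>

lemma locally_valid_residues:
  "\<forall>c\<in>set [0..<9]. \<forall>x\<in>set [0..2 * period c - 1].
     locally_valid (tail False) (tail True) c x \<and> locally_valid (tail True) (tail False) c x"
  by code_simp

section \<open>From residues to all pile sizes\<close>

lemma less_9_cases: "(c::nat) < 9 \<longleftrightarrow> c \<in> {0, 1, 2, 3, 4, 5, 6, 7, 8}"
  by auto

lemma tail_translate:
  assumes "c < 9" and "period c dvd k"
  shows "tail t c (x + k) = tail t c x + k"
proof -
  define row where "row = offsets (if t then if c < 2 then c + 2 else if c < 4 then c - 2 else c else c)"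
  have "int (length row) dvd period c"
    using assms(1) unfolding less_9_cases row_def offsets_def period_def by (cases t) auto
  then have "(x + k) mod int (length row) = x mod int (length row)"
    using assms(2) by (metis dvd_trans mod_add_right_eq add_0_right dvd_imp_mod_0)
  then show ?thesis
    unfolding tail_def Let_def row_def[symmetric] by simp
qed

lemma tail_unswapped: "4 \<le> c \<Longrightarrow> tail t c x = tail t' c x"
  by (simp add: tail_def)

text \<open>The patterns for \<open>c < 4\<close> act within aligned blocks of four. The bounds 28 *
  2 ^ k are multiples of 4, so a pile and its partner see the same pattern.\<close>

lemma tail_div_4:
  assumes "c < 4"
  shows "tail t c x div 4 = x div 4"
proof -
  have "period c = 4"
    using assms by (simp add: period_def)
  then have "tail t c x = tail t c (x mod 4) + 4 * (x div 4)"
    using tail_translate[of c "4 * (x div 4)" t "x mod 4"] assms by simp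
  moreover have "\<forall>c\<in>set [0..<4]. \<forall>r\<in>set [0..3]. tail False c r div 4 = 0 \<and> tail True c r div 4 = 0"
    by code_simp
  then have "tail t c (x mod 4) div 4 = 0"
    using assms by (cases t) auto
  ultimately show ?thesis
    by simp
qed

lemma not_swapped: "x < 28 \<Longrightarrow> \<not> swapped x"
  by (subst swapped.simps) simp

lemma swapped_half: "28 \<le> x \<Longrightarrow> swapped (x div 2) \<longleftrightarrow> \<not> swapped x"
  by (subst (2) swapped.simps) simp

lemma swapped_cong_div_4: "x div 4 = y div 4 \<Longrightarrow> swapped x = swapped y"
proof (induction x arbitrary: y rule: swapped.induct)
  case (1 x)
  show ?case
  proof (cases "x < 28")
    case True
    then have "y < 28"
      using 1(2) by presburger
    with True show ?thesis
      by (simp add: not_swapped)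
  next
    case False
    then have "\<not> y < 28"
      using 1(2) by presburger
    have "swapped (x div 2) = swapped (y div 2)"
    proof (cases "x < 56")
      case True
      then show ?thesis
      proof -
        have "x div 2 < 28" "y div 2 < 28"
          using True 1(2) by presburger+
        then show ?thesis
          by (simp add: not_swapped)
      qed
    next
      case F: False
      have "w div 2 div 4 = w div 4 div 2" for w :: int
        by (simp flip: zdiv_zmult2_eq)
      then have "x div 2 div 4 = y div 2 div 4"
        using 1(2) by simp
      then show ?thesis
        using 1(1)[OF False] by blast
    qed
    with swapped_half False \<open>\<not> y < 28\<close> show ?thesis
      by simp
  qed
qed

lemma partner_eq_tail: "(if c = 8 then 64 else 30) \<le> x \<Longrightarrow> partner c x = tail (swapped x) c x"
  by (auto simp: partner_def split: if_splits)

lemma locally_valid_partner: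
  assumes c: "c < 9" and x: "0 \<le> x"
  shows "locally_valid partner partner c x"
proof (cases "x < tail_start c")
  case True
  then show ?thesis
    using locally_valid_small c x by auto
next
  case False
  \<comment> \<open>60 puts \<open>x div 2\<close> at 30 or more; 73 = 64 + 9 keeps everything
    within 9 of \<open>x\<close> past the initial row of \<open>c = 8\<close>.\<close>
  then have x_large: "60 \<le> x" "c = 8 \<Longrightarrow> 73 \<le> x"
    by (auto simp: tail_start_def split: if_splits)
  define t where "t = swapped x"
  define r where "r = x mod (2 * period c)"
  define d where "d = period c * (x div (2 * period c))"
  have x_eq: "x = r + 2 * d"
    by (simp add: r_def d_def mult.assoc[symmetric])
  have translate: "tail u c' (s + 2 * d) = tail u c' s + 2 * d" if "c' \<le> c" for u c' s
  proof -
    \<comment> \<open>The factor 2 matters for \<open>c = 8\<close>: 8 divides 24 but not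
      12.\<close>
    have "period c' dvd 2 * period c"
      using that c by (auto simp: period_def)
    then show ?thesis
      using that c by (intro tail_translate) (auto simp: d_def simp flip: mult.assoc)
  qed
  have "r \<in> {0..2 * period c - 1}"
    unfolding r_def by (auto simp: period_def)
  then have "locally_valid (tail t) (tail (\<not> t)) c r"
    using locally_valid_residues c by (cases t) auto
  then have valid: "r - 9 \<le> tail t c r" "tail t c r \<le> r + 9" "tail t c (tail t c r) = r"
    "\<And>c'. c' < c \<Longrightarrow> tail t c' r \<noteq> tail t c r"
    "tail (\<not> t) (c div 2) (r div 2) = tail t c r div 2 \<Longrightarrow> r = 0 \<and> c = 0"
    "\<And>s. r - 9 \<le> s \<Longrightarrow> s < tail t c r \<Longrightarrow> r < tail t c s \<Longrightarrow>
      tail (\<not> t) (c div 2) (r div 2) = s div 2 \<or> (\<exists>c'<c. tail t c' r = s)"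
    unfolding locally_valid_def by blast+
  have px: "partner c' x = tail t c' r + 2 * d" if "c' \<le> c" for c'
  proof -
    have "(if c' = 8 then 64 else 30) \<le> x"
      using x_large that c by auto
    then show ?thesis
      using partner_eq_tail[of c' x] translate[OF that, of t r] x_eq by (simp add: t_def)
  qed
  have "swapped (x div 2) = (\<not> t)"
    using swapped_half[of x] x_large by (simp add: t_def)
  moreover have "c div 2 \<noteq> 8" "c div 2 < 9"
    using c by auto
  ultimately have "partner (c div 2) (x div 2) = tail (\<not> t) (c div 2) (x div 2)"
    using partner_eq_tail[of "c div 2" "x div 2"] x_large by simp
  also have "\<dots> = tail (\<not> t) (c div 2) (r div 2) + d"
  proof -
    have "period (c div 2) dvd d"
      using c unfolding d_def less_9_cases by (intro dvd_mult2) (auto simp: period_def)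
    moreover have "x div 2 = r div 2 + d"
      unfolding x_eq by simp
    ultimately show ?thesis
      using tail_translate[OF \<open>c div 2 < 9\<close>, of d "\<not> t" "r div 2"] by simp
  qed
  finally have ph: "partner (c div 2) (x div 2) = \<dots>" .
  have py: "partner c y = tail t c (y - 2 * d) + 2 * d"
    if "30 \<le> y" "c = 8 \<Longrightarrow> 64 \<le> y" "c < 4 \<Longrightarrow> y div 4 = x div 4" for y
  proof -
    have "partner c y = tail (swapped y) c y"
      using that(1,2) by (simp add: partner_eq_tail)
    also have "\<dots> = tail t c y"
    proof (cases "c < 4")
      case True
      then show ?thesis
        using swapped_cong_div_4[of y x] that(3) t_def by simp
    next
      case False
      then show ?thesis
        by (intro tail_unswapped) simp
    qed
    finally show ?thesis
      using translate[OF order_refl, of t "y - 2 * d"] by simp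
  qed
  have pz: "partner c (partner c x) = x"
  proof -
    have "partner c x div 4 = x div 4" if "c < 4"
      using partner_eq_tail[of c x] x_large that tail_div_4[OF that] by simp
    moreover have "30 \<le> partner c x" "c = 8 \<Longrightarrow> 64 \<le> partner c x"
      using px[OF order_refl] valid(1) x_eq x_large by auto
    ultimately have "partner c (partner c x) = tail t c (tail t c r) + 2 * d"
      using py[of "partner c x"] px[OF order_refl] by simp
    then show ?thesis
      using valid(3) x_eq by simp
  qed
  have greedy: "partner (c div 2) (x div 2) = y div 2 \<or> (\<exists>c'<c. partner c' x = y)"
    if y: "x - 9 \<le> y" "y < partner c x" "x < partner c y" for y
  proof -
    have y_large: "30 \<le> y" "c = 8 \<Longrightarrow> 64 \<le> y"
      using y(1) x_large by auto
    \<comment> \<open>Partners stay in their block, so the two strict inequalities squeeze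
      \<open>x\<close> and \<open>y\<close> into one block.\<close>
    have "y div 4 = x div 4" if "c < 4"
    proof (rule antisym)
      have "y div 4 \<le> partner c x div 4"
        using y(2) by (intro zdiv_mono1) auto
      then show "y div 4 \<le> x div 4"
        using partner_eq_tail[of c x] x_large that tail_div_4[OF that] by simp
      have "x div 4 \<le> partner c y div 4"
        using y(3) by (intro zdiv_mono1) auto
      then show "x div 4 \<le> y div 4"
        using partner_eq_tail[of c y] y_large that tail_div_4[OF that] by simp
    qed
    then have "partner c y = tail t c (y - 2 * d) + 2 * d"
      using py y_large by simp
    then have "tail (\<not> t) (c div 2) (r div 2) = (y - 2 * d) div 2 \<or> (\<exists>c'<c. tail t c' r = y - 2 * d)"
      using y px[OF order_refl] x_eq by (intro valid(6)) auto
    moreover have "(y - 2 * d) div 2 = y div 2 - d"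
      by presburger
    ultimately show ?thesis
      using ph px by fastforce
  qed
  have "partner (c div 2) (x div 2) \<noteq> partner c x div 2"
  proof
    assume *: "partner (c div 2) (x div 2) = partner c x div 2"
    have "(tail t c r + 2 * d) div 2 = tail t c r div 2 + d"
      by presburger
    then have "tail (\<not> t) (c div 2) (r div 2) = tail t c r div 2"
      using * ph px[OF order_refl] by simp
    \<comment> \<open>The residue check leaves out \<open>r = 0\<close>, \<open>c = 0\<close>; there
      the two patterns give 0 and 2, and neither is half of the other.\<close>
    moreover have "tail t 0 0 \<in> {0, 2}" "tail (\<not> t) 0 0 \<in> {0, 2}" "tail t 0 0 \<noteq> tail (\<not> t) 0 0"
      by (cases t; simp add: tail_def offsets_def)+
    ultimately show False
      using valid(5) by auto
  qed
  moreover have "partner c' x \<noteq> partner c x" if "c' < c" for c'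
    using valid(4)[OF that] px that by simp
  moreover have "x - 9 \<le> partner c x" "partner c x \<le> x + 9"
    using px[OF order_refl] valid(1,2) x_eq by simp_all
  ultimately show ?thesis
    using pz greedy unfolding locally_valid_def by blast
qed

lemma
  assumes "c < 9" and "0 \<le> x"
  shows partner_partner: "partner c (partner c x) = x"
    and partner_near: "partner c x \<le> x + 9"
    and partner_neq_partner: "c' < c \<Longrightarrow> partner c' x \<noteq> partner c x"
    and partner_half: "partner (c div 2) (x div 2) = partner c x div 2 \<Longrightarrow> x = 0 \<and> c = 0"
  using locally_valid_partner[OF assms] unfolding locally_valid_def by blast+

lemma partner_nonneg:
  assumes "c < 9" and "0 \<le> x"
  shows "0 \<le> partner c x"
proof (rule ccontr)
  assume "\<not> 0 \<le> partner c x"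
  then have "partner c (partner c x) = partner c x"
    by (subst partner_def) simp
  with \<open>\<not> 0 \<le> partner c x\<close> show False
    using partner_partner[OF assms] assms(2) by simp
qed

lemma partner_greedy:
  assumes c: "c < 9" and "0 \<le> x" "0 \<le> y" and y: "y < partner c x" "x < partner c y"
  shows "partner (c div 2) (x div 2) = y div 2 \<or> (\<exists>c'<c. partner c' x = y)"
proof -
  \<comment> \<open>An offset of at most 9 at \<open>y\<close> makes the local range of
    \<open>y\<close> the full one.\<close>
  have "x - 9 \<le> y"
    using partner_near[OF c \<open>0 \<le> y\<close>] y(2) by simp
  then show ?thesis
    using locally_valid_partner[OF assms(1,2)] y
    unfolding locally_valid_def by blast
qed

section \<open>The game with three piles\<close>

lemma P_position_iff: "P_position p \<longleftrightarrow> (\<forall>q. halve_nim_move p q \<longrightarrow> \<not> P_position q)"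
  by (subst P_position.simps) (auto simp: N_position_iff_not_P_position)

lemma halve_nim_move_iff:
  "halve_nim_move p q \<longleftrightarrow>
    (\<exists>m\<in>#p. \<exists>k<m. q = add_mset k (p - {#m#})) \<or>
    ((\<exists>m\<in>#p. 0 < m) \<and> q = image_mset (\<lambda>m. m div 2) p)"
  by (subst halve_nim_move.simps) blast

lemma P_position_3_iff:
  "P_position {#a, b, c#} \<longleftrightarrow>
    (\<forall>k<a. \<not> P_position {#k, b, c#}) \<and> (\<forall>k<b. \<not> P_position {#a, k, c#}) \<and>
    (\<forall>k<c. \<not> P_position {#a, b, k#}) \<and>
    (0 < a + b + c \<longrightarrow> \<not> P_position {#a div 2, b div 2, c div 2#})"
proof -
  have "{#a, b, c#} - {#a#} = {#b, c#}" "{#a, b, c#} - {#b#} = {#a, c#}" "{#a, b, c#} - {#c#} = {#a, b#}"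
    by auto
  then have "halve_nim_move {#a, b, c#} q \<longleftrightarrow>
      (\<exists>k<a. q = {#k, b, c#}) \<or> (\<exists>k<b. q = {#k, a, c#}) \<or> (\<exists>k<c. q = {#k, a, b#}) \<or>
      (0 < a + b + c \<and> q = {#a div 2, b div 2, c div 2#})" for q
    unfolding halve_nim_move_iff by simp
  moreover have "{#k, a, c#} = {#a, k, c#}" "{#k, a, b#} = {#a, b, k#}" for k
    by (simp_all add: add_mset_commute)
  ultimately have moves: "halve_nim_move {#a, b, c#} q \<longleftrightarrow>
      (\<exists>k<a. q = {#k, b, c#}) \<or> (\<exists>k<b. q = {#a, k, c#}) \<or> (\<exists>k<c. q = {#a, b, k#}) \<or>
      (0 < a + b + c \<and> q = {#a div 2, b div 2, c div 2#})" for q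
    by simp
  show ?thesis
    unfolding P_position_iff[of "{#a, b, c#}"] moves by auto
qed

text \<open>Off the graph, lowering \<open>a\<close> or \<open>b\<close> reaches it, or both
  partners are larger and \<open>partner_greedy\<close> supplies a halving or a smaller third pile.
  On it, involutivity excludes the moves in \<open>a\<close> and \<open>b\<close>, local validity
  the others.\<close>

lemma P_position_iff_partner: "c < 9 \<Longrightarrow> P_position {#a, b, c#} \<longleftrightarrow> int b = partner c (int a)"
proof (induction "a + b + c" arbitrary: a b c rule: less_induct)
  case less
  note c = \<open>c < 9\<close>
  have IH: "P_position {#a', b', c'#} \<longleftrightarrow> int b' = partner c' (int a')"
    if "a' + b' + c' < a + b + c" "c' \<le> c" for a' b' c'
    using less(1)[OF that(1)] that(2) c by simp
  have half: "P_position {#a div 2, b div 2, c div 2#} \<longleftrightarrow> int b div 2 = partner (c div 2) (int a div 2)"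
    if "0 < a + b + c"
  proof -
    have "a div 2 + b div 2 + c div 2 < a + b + c"
      using that by linarith
    then show ?thesis
      by (subst IH) (auto simp: zdiv_int)
  qed
  have moves: "P_position {#a, b, c#} \<longleftrightarrow>
    (\<forall>k<a. int b \<noteq> partner c (int k)) \<and> (\<forall>k<b. int k \<noteq> partner c (int a)) \<and>
    (\<forall>k<c. int b \<noteq> partner k (int a)) \<and>
    (0 < a + b + c \<longrightarrow> int b div 2 \<noteq> partner (c div 2) (int a div 2))"
    by (subst P_position_3_iff) (simp add: IH half)
  show ?case
  proof
    assume P: "P_position {#a, b, c#}"
    show "int b = partner c (int a)"
    proof (rule ccontr)
      assume neq: "int b \<noteq> partner c (int a)"
      have "\<not> partner c (int a) < int b"
      proof
        assume "partner c (int a) < int b"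
        moreover obtain k where "partner c (int a) = int k"
          using partner_nonneg[OF c, of "int a"] nonneg_int_cases by auto
        ultimately show False
          using P moves by auto
      qed
      moreover have "\<not> partner c (int b) < int a"
      proof
        assume less: "partner c (int b) < int a"
        obtain k where k: "partner c (int b) = int k"
          using partner_nonneg[OF c, of "int b"] nonneg_int_cases by auto
        have "int b = partner c (int k)"
          using partner_partner[OF c, of "int b"] k by simp
        with less k show False
          using P moves by auto
      qed
      moreover have "partner c (int b) \<noteq> int a"
        using partner_partner[OF c, of "int b"] neq by auto
      ultimately have "int b < partner c (int a)" "int a < partner c (int b)"
        using neq by auto
      \<comment> \<open>Halving is available: (0, 0, 0) is excluded by
        \<open>partner 0 0 = 0\<close>.\<close>
      moreover from this have "0 < a + b + c"
        by (auto intro!: Nat.gr0I simp: partner_def initial_row_def)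
      ultimately show False
        using partner_greedy[OF c, of "int a" "int b"] P moves by force
    qed
  next
    assume b: "int b = partner c (int a)"
    have "int b \<noteq> partner c (int k)" if "k < a" for k
      using partner_partner[OF c, of "int a"] partner_partner[OF c, of "int k"] b that by auto
    moreover have "int b \<noteq> partner k (int a)" if "k < c" for k
      using partner_neq_partner[OF c, of "int a" k] b that by auto
    moreover have "int b div 2 \<noteq> partner (c div 2) (int a div 2)" if "0 < a + b + c"
    proof
      assume "int b div 2 = partner (c div 2) (int a div 2)"
      then have "int a = 0 \<and> c = 0"
        using partner_half[OF c, of "int a"] b by simp
      moreover from this b have "b = 0"
        by (simp add: partner_def initial_row_def)
      ultimately show False
        using that by simp
    qed
    ultimately show "P_position {#a, b, c#}"
      using moves b by auto
  qed
qed

section \<open>Identification with \<open>phi8\<close>\<close>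

text \<open>As 6 < 8, the XOR changes only the lowest three bits.\<close>

lemma xor_6_translate: "Bit_Operations.xor (8 * k + z) 6 = 8 * k + Bit_Operations.xor z 6" for z :: int
proof -
  have "Bit_Operations.xor w 6 = of_bool (odd w) + 2 * Bit_Operations.xor (w div 2) 3" for w :: int
    by (subst xor_int_rec) simp
  moreover have "Bit_Operations.xor w 3 = of_bool (even w) + 2 * Bit_Operations.xor (w div 2) 1" for w :: int
    by (subst xor_int_rec) simp
  moreover have "(8 * k + z) div 2 = 4 * k + z div 2" "(4 * k + z div 2) div 2 = 2 * k + z div 2 div 2"
    by presburger+
  ultimately show ?thesis
    by (simp add: xor_one_eq)
qed

text \<open>From 64 on, both sides commute with a shift by 24, which is a multiple of 8, the length
  of \<open>S8\<close> and twice the period of the offsets; so 24 values decide.\<close>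

lemma partner_8: "partner 8 (int a) = int (phi8 a)"
proof (cases "a < 64")
  case True
  have "initial_row 8 = map int phi8_initial"
    by (simp add: initial_row_def phi8_initial_def)
  with True show ?thesis
    by (simp add: partner_def phi8_def length_phi8_initial)
next
  case False
  define r where "r = (a - 64) mod 24"
  define k where "k = (a - 64) div 24"
  have "a = 64 + (24 * k + r)"
    using False by (simp add: r_def k_def)
  then have a: "int a = 8 * (8 + 3 * int k) + int r"
    by simp
  have "int (phi8 a) = shifted_xor (S8 ! r) (8 * (8 + 3 * int k) + int r) 6"
    using int_phi8[of a] False unfolding a r_def[symmetric] by simp
  also have "\<dots> = 24 * int k + (64 + shifted_xor (S8 ! r) (int r) 6)"
    using xor_6_translate[of "8 + 3 * int k" "int r + S8 ! r"] by (simp add: shifted_xor_def add.assoc)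
  also have "64 + shifted_xor (S8 ! r) (int r) 6 = tail False 8 (64 + int r)"
  proof -
    have "r < 24"
      by (simp add: r_def)
    then have "r \<in> set [0..<24]"
      by simp
    moreover have "\<forall>r\<in>set [0..<24]. 64 + shifted_xor (S8 ! r) (int r) 6 = tail False 8 (64 + int r)"
      by code_simp
    ultimately show ?thesis
      by blast
  qed
  also have "24 * int k + \<dots> = tail False 8 (int a)"
    using tail_translate[of 8 "24 * int k" False "64 + int r"] by (simp add: a period_def algebra_simps)
  also have "\<dots> = partner 8 (int a)"
    using False tail_unswapped[of 8 False "int a" "swapped (int a)"] by (simp add: partner_eq_tail)
  finally show ?thesis
    by simp
qed

theorem theorem39:
  fixes a b :: nat
  shows "P_position {#a, b, 8#} \<longleftrightarrow> b = phi8 a"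
  by (simp add: P_position_iff_partner partner_8)

end
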